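(* Under the standing assumptions below, the global-worst-case prediction set \[ \hat C^{\mathrm{gwc}}(X^{n+1}):=\{y\in\mathbb{R}^d:\ 0\le E_j(X^{n+1},y)\le \omega_j(\hat Q^{\mathrm{gwc}}_{1-\alpha})\ \ \forall j\in[d]\} \] satisfies $\mathbb{P}[Y^{n+1}\in\hat C^{\mathrm{gwc}}(X^{n+1})]\ge 1-\alpha$.
   Context: Setting: $n\ge2$, $d\ge1$, $\alpha\in(0,1)$. $(X^i,Y^i)$, $i\in[n+1]$, are random with $X^i$ in a feature space $\mathcal X$ and $Y^i\in\mathbb{R}^d$; $E:\mathcal X\times\mathbb{R}^d\to\mathbb{R}^d$ is a fixed (data-independent) residual function and $E^i:=E(X^i,Y^i)$. $(E^1,\dots,E^{n+1})$ is exchangeable. Assumption A: for each $j$, the distribution of $E^i_j$ has no point masses, $E^i_j\ge0$ a.s., $\mathbb{E}[E^i_j]<\infty$, $0<\mathrm{Var}(E^i_j)<\infty$, and $E^1_j,\dots,E^{n+1}_j$ are a.s. pairwise distinct. Quantile: $\hat Q_{1-\alpha}(x_1,\dots,x_n)$ is the $\lceil(1-\alpha)(n+1)\rceil$-th smallest value of $\{x_1,\dots,x_n,+\infty\}$. Calibration statistics: $\hat\mu_j=\frac1n\sum_{i=1}^nE^i_j$, $\hat\sigma_j=\sqrt{\frac1n\sum_{i=1}^n(E^i_j-\hat\mu_j)^2}$. For $z\ge0$: $\hat\mu_j(z)=\frac{\sum_{i=1}^nE^i_j+z}{n+1}$, $\hat\sigma_j(z)=\sqrt{\frac{\sum_{i=1}^n(E^i_j-\hat\mu_j(z))^2+(z-\hat\mu_j(z))^2}{n}}$.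 GWC transformation: $\hat\Phi^{\mathrm{gwc}}(t):=\max_{1\le j\le d}\sup_{z_j\ge0}\frac{t_j-\hat\mu_j(z_j)}{\hat\sigma_j(z_j)}$ for $t\in\mathbb{R}^d_+$; $S^i_{\mathrm{gwc}}:=\hat\Phi^{\mathrm{gwc}}(E^i)$, $\hat Q^{\mathrm{gwc}}_{1-\alpha}:=\hat Q_{1-\alpha}(S^1_{\mathrm{gwc}},\dots,S^n_{\mathrm{gwc}})$. Link functions: $\omega_j(c)=0$ if $c\le-\frac n{\sqrt{n+1}}$; $\max\{0,\hat\mu_j-\hat\sigma_j|c|\sqrt{\tfrac{(n+1)^2}{n^2-(n+1)c^2}}\}$ if $-\frac n{\sqrt{n+1}}<c<0$; $\hat\mu_j+\hat\sigma_j|c|\sqrt{\tfrac{(n+1)^2}{n^2-(n+1)c^2}}$ if $0\le c<\frac n{\sqrt{n+1}}$; $+\infty$ if $c\ge\frac n{\sqrt{n+1}}$. *)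

theory Defs
  imports "HOL-Probability.Probability"
begin

text \<open>Calibration residuals are given as a function cal :: nat => real^'d, used on indices 1..n.
  The dimension d is the cardinality of the finite index type 'd.\<close>

definition mu_hat :: "nat \<Rightarrow> (nat \<Rightarrow> real^'d) \<Rightarrow> 'd \<Rightarrow> real" where
  "mu_hat n cal j = (\<Sum>i=1..n. cal i $ j) / real n"

definition sigma_hat :: "nat \<Rightarrow> (nat \<Rightarrow> real^'d) \<Rightarrow> 'd \<Rightarrow> real" where
  "sigma_hat n cal j = sqrt ((\<Sum>i=1..n. (cal i $ j - mu_hat n cal j)^2) / real n)"

definition mu_z :: "nat \<Rightarrow> (nat \<Rightarrow> real^'d) \<Rightarrow> 'd \<Rightarrow> real \<Rightarrow> real" where
  "mu_z n cal j z = ((\<Sum>i=1..n. cal i $ j) + z) / (real n + 1)"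

definition sigma_z :: "nat \<Rightarrow> (nat \<Rightarrow> real^'d) \<Rightarrow> 'd \<Rightarrow> real \<Rightarrow> real" where
  "sigma_z n cal j z = sqrt (((\<Sum>i=1..n. (cal i $ j - mu_z n cal j z)^2)
                              + (z - mu_z n cal j z)^2) / real n)"

definition phi_gwc :: "nat \<Rightarrow> (nat \<Rightarrow> real^'d) \<Rightarrow> real^'d \<Rightarrow> ereal" where
  "phi_gwc n cal t = Max (range (\<lambda>j::'d.
      SUP z\<in>{0::real..}. ereal ((t $ j - mu_z n cal j z) / sigma_z n cal j z)))"

definition conf_quantile :: "real \<Rightarrow> ereal list \<Rightarrow> ereal" where
  "conf_quantile \<alpha> xs =
     sort (xs @ [\<infinity>]) ! (nat \<lceil>(1 - \<alpha>) * (real (length xs) + 1)\<rceil> - 1)"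

definition Q_gwc :: "nat \<Rightarrow> (nat \<Rightarrow> real^'d) \<Rightarrow> real \<Rightarrow> ereal" where
  "Q_gwc n cal \<alpha> = conf_quantile \<alpha> (map (\<lambda>i. phi_gwc n cal (cal i)) [1..<n+1])"

definition omega :: "nat \<Rightarrow> (nat \<Rightarrow> real^'d) \<Rightarrow> 'd \<Rightarrow> ereal \<Rightarrow> ereal" where
  "omega n cal j c =
     (let b = real n / sqrt (real n + 1); r = real_of_ereal c;
          w = sigma_hat n cal j * \<bar>r\<bar> *
              sqrt ((real n + 1)^2 / ((real n)^2 - (real n + 1) * r^2))
      in if c \<le> ereal (- b) then 0
         else if c < 0 then ereal (max 0 (mu_hat n cal j - w))
         else if c < ereal b then ereal (mu_hat n cal j + w)
         else \<infinity>)"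

definition C_gwc :: "nat \<Rightarrow> (nat \<Rightarrow> real^'d) \<Rightarrow> real \<Rightarrow> ('x \<Rightarrow> real^'d \<Rightarrow> real^'d) \<Rightarrow> 'x
                     \<Rightarrow> (real^'d) set" where
  "C_gwc n cal \<alpha> E x = {y. \<forall>j. 0 \<le> E x y $ j \<and>
        ereal (E x y $ j) \<le> omega n cal j (Q_gwc n cal \<alpha>)}"

end

theory Submission
  imports Defs
begin

text \<open>Standardise all \<open>n + 1\<close> residuals with the mean and deviation of the whole sample, that is, with
  \<open>z_j = E_j^(n+1)\<close>. These statistics are symmetric, so the resulting scores \<open>V_i\<close> are exchangeable, and
  counting ranks bounds the probability that fewer than \<open>k = \<lceil>(1 - \<alpha>)(n + 1)\<rceil>\<close> scores lie strictly
  below \<open>V_(n+1)\<close> from below by \<open>k / (n + 1)\<close>. The supremum over \<open>z_j \<ge> 0\<close> dominates \<open>V_i\<close>, hence on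
  this event \<open>V_(n+1)\<close> is at most the worst-case quantile, and solving the resulting inequality for
  \<open>E_j^(n+1)\<close> gives the link function. Since \<^const>\<open>measure\<close> is \<open>0\<close> on non-measurable sets, the coverage
  event must also be shown to be measurable, although the quantile involves an uncountable supremum.\<close>

section \<open>Order statistics and the conformal quantile\<close>

text \<open>In a sorted list the entries below \<open>a\<close> form an initial segment, so position
  \<open>j\<close> belongs to it exactly when the segment is longer than \<open>j\<close>; sorting
  does not change its length.\<close>

lemma sort_nth_less_iff:
  fixes xs :: "'a::linorder list"
  assumes "j < length xs"
  shows "sort xs ! j < a \<longleftrightarrow> j < length (filter (\<lambda>x. x < a) xs)"
proof -
  let ?s = "sort xs"
  have len: "length (filter (\<lambda>x. x < a) xs) = card {i. i < length ?s \<and> ?s ! i < a}"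
    using length_filter_conv_card[of "\<lambda>x. x < a" ?s] by (simp only: filter_sort length_sort)
  have mono: "?s ! i \<le> ?s ! l" if "i \<le> l" "l < length xs" for i l
    using that by (simp add: sorted_nth_mono)
  show ?thesis
  proof
    assume *: "?s ! j < a"
    have "{..j} \<subseteq> {i. i < length ?s \<and> ?s ! i < a}"
      using mono[OF _ assms] * assms by (auto intro: le_less_trans)
    from card_mono[OF _ this] show "j < length (filter (\<lambda>x. x < a) xs)"
      using len by simp
  next
    assume *: "j < length (filter (\<lambda>x. x < a) xs)"
    show "?s ! j < a"
    proof (rule ccontr)
      assume n: "\<not> ?s ! j < a"
      have "{i. i < length ?s \<and> ?s ! i < a} \<subseteq> {..<j}"
      proof safe
        fix i assume i: "i < length ?s" "?s ! i < a"
        show "i < j"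
        proof (rule ccontr)
          assume "\<not> i < j"
          with mono[of j i] i n show False by auto
        qed
      qed
      from card_mono[OF _ this] show False using * len by simp
    qed
  qed
qed

lemma quantile_index_le:
  fixes \<alpha> :: real
  assumes "0 < \<alpha>"
  shows "nat \<lceil>(1 - \<alpha>) * (real n + 1)\<rceil> \<le> n + 1"
proof -
  have "(1 - \<alpha>) * (real n + 1) \<le> 1 * (real n + 1)"
    using assms by (intro mult_right_mono) auto
  then show ?thesis by (simp add: nat_le_iff ceiling_le_iff add.commute)
qed

text \<open>The appended infinity is never strictly below \<open>a\<close>, so only the
  \<open>n\<close> given values are counted; if the rank is \<open>n + 1\<close>, the quantile is
  infinite and both sides are false. Bounds and measurability of the quantile thus reduce to finite
  counts.\<close>

lemma conf_quantile_less_iff: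
  fixes f :: "nat \<Rightarrow> ereal"
  assumes "0 < \<alpha>" "\<alpha> < 1"
  shows "conf_quantile \<alpha> (map f [1..<n+1]) < a
     \<longleftrightarrow> nat \<lceil>(1 - \<alpha>) * (real n + 1)\<rceil> \<le> card {i\<in>{1..n}. f i < a}"
proof -
  define k where "k = nat \<lceil>(1 - \<alpha>) * (real n + 1)\<rceil>"
  \<comment> \<open>\<open>\<alpha> < 1\<close> puts the rank at 1 or more, so \<open>k - 1\<close>
    is not truncated and is the zero-based position of the \<open>k\<close>-th smallest
    value.\<close>
  have k0: "0 < k" using assms by (simp add: k_def)
  have k1: "k \<le> n + 1" unfolding k_def using assms(1) by (rule quantile_index_le)
  have cnt: "length (filter (\<lambda>x. x < a) (map f [1..<n+1] @ [\<infinity>])) = card {i\<in>{1..n}. f i < a}"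
  proof -
    have "length (filter (\<lambda>x. x < a) (map f [1..<n+1] @ [\<infinity>]))
        = length (filter (\<lambda>i. f i < a) [1..<n+1])"
      by (simp add: filter_map comp_def del: upt_Suc)
    also have "\<dots> = card (set (filter (\<lambda>i. f i < a) [1..<n+1]))"
      by (rule distinct_card[symmetric]) simp
    also have "set (filter (\<lambda>i. f i < a) [1..<n+1]) = {i\<in>{1..n}. f i < a}"
      by auto
    finally show ?thesis .
  qed
  have "conf_quantile \<alpha> (map f [1..<n+1]) = sort (map f [1..<n+1] @ [\<infinity>]) ! (k - 1)"
    by (simp add: conf_quantile_def k_def del: upt_Suc)
  also have "\<dots> < a \<longleftrightarrow> k - 1 < card {i\<in>{1..n}. f i < a}"
    unfolding cnt[symmetric] using k0 k1 by (intro sort_nth_less_iff) (simp del: upt_Suc)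
  finally show ?thesis using k0 by (auto simp: k_def[symmetric])
qed

section \<open>Rank counting\<close>

text \<open>If fewer than \<open>k\<close> indices had this property, a minimiser of
  \<open>V\<close> among the others would have all its strict predecessors among those few, hence
  fewer than \<open>k\<close> of them, and would have the property itself. Counting strict
  predecessors keeps this true under ties.\<close>

lemma card_rank_less:
  fixes V :: "'i \<Rightarrow> 'b::linorder"
  assumes "finite I" "k \<le> card I"
  shows "k \<le> card {m\<in>I. card {i\<in>I. V i < V m} < k}"
proof (rule ccontr)
  let ?B = "{m\<in>I. card {i\<in>I. V i < V m} < k}"
  assume "\<not> k \<le> card ?B"
  then have less: "card ?B < k" by simp
  have "\<not> I \<subseteq> ?B"
    using less assms card_mono[of ?B I] by auto
  then have ne: "I - ?B \<noteq> {}" by blast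
  define m where "m = arg_min_on V (I - ?B)"
  have m: "m \<in> I - ?B" "\<And>i. i \<in> I - ?B \<Longrightarrow> V m \<le> V i"
    using arg_min_if_finite(1)[OF _ ne, of V] arg_min_least[OF _ ne, of _ V] assms(1)
    unfolding m_def by blast+
  have "{i\<in>I. V i < V m} \<subseteq> ?B" using m(2) by force
  from card_mono[OF _ this] assms(1) less have "card {i\<in>I. V i < V m} < k" by simp
  with m(1) show False by simp
qed

text \<open>Double counting: the number of events containing an outcome is a sum of indicators; it
  is at least \<open>k\<close> pointwise, and its expectation is the sum of the
  probabilities.\<close>

lemma (in prob_space) equiprobable_cover:
  assumes "finite I" and A: "\<And>m. m \<in> I \<Longrightarrow> A m \<in> events" "\<And>m. m \<in> I \<Longrightarrow> prob (A m) = p"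
    and k: "\<And>\<omega>. \<omega> \<in> space M \<Longrightarrow> k \<le> card {m\<in>I. \<omega> \<in> A m}"
  shows "real k \<le> real (card I) * p"
proof -
  have "real k = expectation (\<lambda>_. real k)" by (simp add: prob_space)
  also have "\<dots> \<le> expectation (\<lambda>\<omega>. \<Sum>m\<in>I. indicator (A m) \<omega>)"
  proof (rule integral_mono)
    show "integrable M (\<lambda>\<omega>. \<Sum>m\<in>I. indicator (A m) \<omega> :: real)"
      using A by (intro Bochner_Integration.integrable_sum integrable_real_indicator) (auto simp: emeasure_eq_measure)
    fix \<omega> assume "\<omega> \<in> space M"
    have "(\<Sum>m\<in>I. indicator (A m) \<omega> :: real) = real (card {m\<in>I. \<omega> \<in> A m})"
      using \<open>finite I\<close> by (simp add: indicator_def of_bool_def sum.If_cases Int_def)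
    then show "real k \<le> (\<Sum>m\<in>I. indicator (A m) \<omega>)" using k[OF \<open>\<omega> \<in> space M\<close>] by simp
  qed simp
  also have "\<dots> = (\<Sum>m\<in>I. prob (A m))"
    using A by (subst Bochner_Integration.integral_sum) (auto simp: emeasure_eq_measure intro!: sum.cong)
  also have "\<dots> = real (card I) * p" using A by simp
  finally show ?thesis .
qed

section \<open>Mean and deviation after adding one value\<close>

lemma diff_mu_z:
  assumes "n > 0"
  shows "t - mu_z n cal j t = real n * (t - mu_hat n cal j) / (real n + 1)"
proof -
  have "mu_z n cal j t = (real n * mu_hat n cal j + t) / (real n + 1)"
    using assms by (simp add: mu_z_def mu_hat_def)
  then show ?thesis by (simp add: field_simps)
qed

text \<open>Expanding around the calibration mean removes the cross term, since the deviations sum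
  to zero. The shift of the mean and the new value together contribute
  \<open>n * ((t - m)^2 / (n + 1))\<close>. Both deviations divide by \<open>n\<close>, so
  \<open>sigma_hat\<close> enters without a factor.\<close>

lemma sigma_z_eq:
  assumes "n > 0"
  shows "sigma_z n cal j t = sqrt ((sigma_hat n cal j)\<^sup>2 + (t - mu_hat n cal j)\<^sup>2 / (real n + 1))"
proof -
  define m where "m = mu_hat n cal j"
  define q where "q = mu_z n cal j t"
  define S where "S = (\<Sum>i=1..n. (cal i $ j - m)\<^sup>2)"
  have s0: "(\<Sum>i=1..n. (cal i $ j - m)) = 0"
    using assms by (simp add: m_def mu_hat_def sum_subtractf)
  have q: "q - m = (t - m) / (real n + 1)" "t - q = real n * (t - m) / (real n + 1)"
    using diff_mu_z[OF assms, of t cal j] by (simp_all add: q_def m_def field_simps)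
  have "(\<Sum>i=1..n. (cal i $ j - q)\<^sup>2)
      = (\<Sum>i=1..n. (cal i $ j - m)\<^sup>2 - 2 * (q - m) * (cal i $ j - m) + (q - m)\<^sup>2)"
    by (intro sum.cong refl) (simp add: power2_eq_square algebra_simps)
  also have "\<dots> = S + n * (q - m)\<^sup>2"
    using s0 by (simp add: sum.distrib sum_subtractf S_def flip: sum_distrib_left)
  finally have "(\<Sum>i=1..n. (cal i $ j - q)\<^sup>2) + (t - q)\<^sup>2 = S + (n * (q - m)\<^sup>2 + (t - q)\<^sup>2)"
    by simp
  also have "n * (q - m)\<^sup>2 + (t - q)\<^sup>2 = n * ((t - m)\<^sup>2 / (real n + 1))"
  proof -
    define N where "N = real n + 1"
    have "N > 0" and n: "real n = N - 1" by (simp_all add: N_def)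
    then show ?thesis unfolding q N_def[symmetric] n
      by (simp add: power_divide field_simps) (simp add: power2_eq_square algebra_simps)
  qed
  finally have "((\<Sum>i=1..n. (cal i $ j - q)\<^sup>2) + (t - q)\<^sup>2) / n = S / n + (t - m)\<^sup>2 / (real n + 1)"
    using assms by (simp add: add_divide_distrib)
  moreover have "(sigma_hat n cal j)\<^sup>2 = S / n"
    by (simp add: sigma_hat_def S_def m_def sum_nonneg)
  ultimately show ?thesis by (simp add: sigma_z_def q_def m_def)
qed

lemma sigma_z_pos:
  assumes "n > 0" "sigma_hat n cal j \<noteq> 0 \<or> t \<noteq> mu_hat n cal j"
  shows "0 < sigma_z n cal j t"
proof -
  have "0 < (sigma_hat n cal j)\<^sup>2 + (t - mu_hat n cal j)\<^sup>2 / (real n + 1)"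
  proof (cases "t = mu_hat n cal j")
    case True
    then show ?thesis using assms(2) by simp
  next
    case False
    then show ?thesis by (intro add_nonneg_pos divide_pos_pos) simp_all
  qed
  then show ?thesis unfolding sigma_z_eq[OF assms(1)] by simp
qed

lemma sigma_hat_pos:
  assumes "i \<in> {1..n}" "k \<in> {1..n}" "cal i $ j \<noteq> cal k $ j"
  shows "0 < sigma_hat n cal j"
proof -
  \<comment> \<open>Two different values cannot both equal the mean.\<close>
  obtain l where l: "l \<in> {1..n}" "cal l $ j \<noteq> mu_hat n cal j"
    using assms by metis
  have "0 < (\<Sum>i=1..n. (cal i $ j - mu_hat n cal j)\<^sup>2)"
    by (rule sum_pos2[of _ l]) (use l in auto)
  then show ?thesis using assms(1) by (simp add: sigma_hat_def)
qed

section \<open>The link function as inverse of the score\<close>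

text \<open>The score of \<open>t\<close> against the pooled sample is increasing in \<open>t\<close> with range
  \<open>(- n / sqrt (n+1), n / sqrt (n+1))\<close>; \<^const>\<open>omega\<close> inverts it.\<close>

lemma le_omega:
  assumes n: "n > 0" and s: "0 < sigma_hat n cal j" and t: "0 \<le> t"
    and le: "ereal ((t - mu_z n cal j t) / sigma_z n cal j t) \<le> c"
  shows "ereal t \<le> omega n cal j c"
proof -
  define N where "N = real n + 1"
  define m s u where "m = mu_hat n cal j" and "s = sigma_hat n cal j" and "u = t - m"
  define b where "b = real n / sqrt N"
  define T where "T = sqrt (s\<^sup>2 + u\<^sup>2 / N)"
  have N: "N > 0" and s0: "s > 0" and n0: "real n > 0" using n s by (simp_all add: N_def s_def)
  have b0: "b > 0" using n0 N by (simp add: b_def)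
  have T2: "T\<^sup>2 = s\<^sup>2 + u\<^sup>2 / N" using N by (simp add: T_def)
  have T0: "T > 0" using N s0 by (simp add: T_def add_pos_nonneg)
  have le': "ereal (real n * u / N / T) \<le> c"
    using le unfolding diff_mu_z[OF n] sigma_z_eq[OF n] by (simp add: u_def m_def s_def T_def N_def)
  \<comment> \<open>Since \<open>s > 0\<close>, the quantity \<open>N * T^2 = N * s^2 + u^2\<close>
    exceeds \<open>u^2\<close>, so the score stays strictly above \<open>- b\<close>. This rules out
    the first branch of \<open>omega\<close>.\<close>
  have gt: "- b < real n * u / N / T"
  proof -
    have "\<bar>u\<bar> < T * sqrt N"
      using N s0 by (auto simp: T_def simp flip: real_sqrt_mult
          intro!: real_less_rsqrt simp: field_simps)
    then have "- u < T * sqrt N" by simp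
    then have "- u / T < sqrt N" using T0 by (simp add: field_simps)
    then have "real n / N * (- u / T) < real n / N * sqrt N"
      using n0 N by (intro mult_strict_left_mono) simp_all
    also have "real n / N * sqrt N = b" using N by (simp add: b_def field_simps)
    finally show ?thesis by simp
  qed
  have main: "ereal t \<le> (if c < 0 then ereal (max 0 (m - w)) else if c < ereal b then ereal (m + w) else \<infinity>)"
    if w: "w = s * \<bar>real_of_ereal c\<bar> * sqrt (N\<^sup>2 / ((real n)\<^sup>2 - N * (real_of_ereal c)\<^sup>2))" for w
  proof (cases "c < ereal b")
    case False
    then show ?thesis using b0 by (cases c) auto
  next
    case True
    with le' obtain r where r: "c = ereal r" by (cases c) auto
    have rle: "real n * u \<le> r * (N * T)"
      using le' N T0 by (simp add: r field_simps)
    \<comment> \<open>This bound makes the denominator under the root in \<open>omega\<close>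
      positive.\<close>
    have rb: "\<bar>r\<bar> < b" using True gt le' r by auto
    have "r\<^sup>2 < b\<^sup>2" using power_strict_mono[OF rb, of 2] by simp
    then have D: "(real n)\<^sup>2 - N * r\<^sup>2 > 0" using N by (simp add: b_def power_divide field_simps)
    define D where "D = (real n)\<^sup>2 - N * r\<^sup>2"
    have D0: "D > 0" using D by (simp add: D_def)
    have w2: "w\<^sup>2 * D = s\<^sup>2 * r\<^sup>2 * N\<^sup>2"
      using D0 by (simp add: w r D_def[symmetric] power_mult_distrib)
    have w0: "0 \<le> w" using s0 D0 by (simp add: w r D_def[symmetric])
    \<comment> \<open>The identity behind the link function: as \<open>D > 0\<close>, comparing the
      squares of the two sides of \<open>rle\<close> amounts to comparing \<open>w\<close> and
      \<open>u\<close> in absolute value.\<close>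
    have sq: "(r * (N * T))\<^sup>2 - (real n * u)\<^sup>2 = w\<^sup>2 * D - u\<^sup>2 * D"
    proof -
      have "(N * T)\<^sup>2 = N\<^sup>2 * s\<^sup>2 + N * u\<^sup>2"
        unfolding power_mult_distrib T2 using N by (simp add: field_simps power2_eq_square)
      then have "(r * (N * T))\<^sup>2 = r\<^sup>2 * (N\<^sup>2 * s\<^sup>2 + N * u\<^sup>2)"
        by (simp only: power_mult_distrib[of r])
      then show ?thesis unfolding w2 by (simp add: power_mult_distrib[of "real n"] D_def algebra_simps)
    qed
    show ?thesis
    proof (cases "r < 0")
      \<comment> \<open>Both sides of \<open>rle\<close> are nonpositive here, so squaring reverses
        the inequality and \<open>u\<close> is at most \<open>- w\<close>.\<close>
      case neg: True
      have "0 \<le> - (r * (N * T))" using neg N T0 by (simp add: mult_nonpos_nonneg)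
      then have "(r * (N * T))\<^sup>2 \<le> (real n * u)\<^sup>2"
        using rle power_mono[of "- (r * (N * T))" "- (real n * u)" 2] by simp
      then have "w\<^sup>2 * D \<le> u\<^sup>2 * D" using sq by simp
      then have "w\<^sup>2 \<le> (- u)\<^sup>2" using D0 by simp
      moreover have "u \<le> 0"
      proof -
        have "real n * u \<le> 0" using rle \<open>0 \<le> - (r * (N * T))\<close> by linarith
        then show ?thesis using n0 by (simp add: mult_le_0_iff)
      qed
      ultimately have "w \<le> - u" using power2_le_imp_le[of w "- u"] by simp
      then show ?thesis using neg by (simp add: r u_def le_max_iff_disj)
    next
      case pos: False
      have "u \<le> w"
      proof (cases "u \<le> 0")
        case False
        then have "(real n * u)\<^sup>2 \<le> (r * (N * T))\<^sup>2"
          using rle by (intro power_mono) simp_all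
        then have "u\<^sup>2 * D \<le> w\<^sup>2 * D" using sq by simp
        then show ?thesis using D0 w0 power2_le_imp_le[of u w] by simp
      qed (use w0 in simp)
      then show ?thesis using pos True by (simp add: r u_def)
    qed
  qed
  have "\<not> c \<le> ereal (- b)" using gt le' by (cases c) auto
  with main[OF refl] show ?thesis
    unfolding omega_def Let_def N_def[symmetric] b_def[symmetric] m_def[symmetric] s_def[symmetric]
    by (simp only: if_False)
qed


section \<open>Measurability of the quantile and the link function\<close>

text \<open>The ratio is continuous in \<open>z\<close> wherever \<^const>\<open>sigma_z\<close> is positive. That fails at most at
  \<open>z = mu_hat n cal j\<close>, where the ratio takes the junk value \<open>x / 0 = 0\<close>; adding this one point
  reduces the uncountable supremum to a countable one.\<close>

lemma SUP_gwc_countable: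
  fixes cal :: "nat \<Rightarrow> real^'d" and a :: real and j :: 'd
  assumes n: "n > 0"
  defines "g \<equiv> \<lambda>z. ereal ((a - mu_z n cal j z) / sigma_z n cal j z)"
  shows "(SUP z\<in>{0..}. g z) = sup (SUP q\<in>{0..} \<inter> \<rat>. g q) (g (max 0 (mu_hat n cal j)))"
    (is "_ = ?R")
proof (rule antisym)
  \<comment> \<open>Taking \<open>max 0\<close> keeps the extra point inside the index set of the
    supremum.\<close>
  show "?R \<le> (SUP z\<in>{0..}. g z)"
    by (intro sup_least SUP_subset_mono SUP_upper) auto
  show "(SUP z\<in>{0..}. g z) \<le> ?R"
  proof (rule SUP_least)
    fix z :: real assume z: "z \<in> {0..}"
    show "g z \<le> ?R"
    proof (cases "z = mu_hat n cal j")
      case True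
      then have "max 0 (mu_hat n cal j) = z" using z by simp
      then show ?thesis by simp
    next
      case False
      then have pos: "sigma_z n cal j z > 0" using sigma_z_pos[OF n] by blast
      have "isCont (\<lambda>z. sigma_z n cal j z) z" "isCont (\<lambda>z. mu_z n cal j z) z"
        unfolding sigma_z_def mu_z_def using n by (intro continuous_intros; simp)+
      then have cont: "isCont (\<lambda>z. (a - mu_z n cal j z) / sigma_z n cal j z) z"
        using pos by (intro continuous_intros) auto
      \<comment> \<open>The approximating rationals are chosen above \<open>z\<close>, so they stay
        nonnegative even for \<open>z = 0\<close>.\<close>
      have "\<exists>q\<in>\<rat>. z < q \<and> q < z + inverse (real (Suc k))" for k
        by (intro Rats_dense_in_real) simp
      then obtain q where q: "q k \<in> \<rat>" "z < q k" "q k < z + inverse (real (Suc k))" for k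
        by metis
      have "(\<lambda>k. z + inverse (real (Suc k))) \<longlonglongrightarrow> z + 0"
        by (intro tendsto_intros LIMSEQ_inverse_real_of_nat)
      then have "q \<longlonglongrightarrow> z"
        by (intro tendsto_sandwich[of "\<lambda>_. z" q _ "\<lambda>k. z + inverse (real (Suc k))"])
          (use q(2,3) in \<open>auto intro!: always_eventually less_imp_le\<close>)
      from isCont_tendsto_compose[OF cont this] have "(\<lambda>k. g (q k)) \<longlonglongrightarrow> g z"
        unfolding g_def by (intro tendsto_ereal)
      moreover have "g (q k) \<le> ?R" for k
        using q[of k] z by (intro le_supI1 SUP_upper) auto
      ultimately show ?thesis by (intro LIMSEQ_le_const2) auto
    qed
  qed
qed

lemma measurable_vec_nth [measurable (raw)]:
  fixes f :: "'a \<Rightarrow> real^'d"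
  assumes "f \<in> borel_measurable M"
  shows "(\<lambda>x. f x $ j) \<in> borel_measurable M"
  by (rule measurable_compose[OF assms borel_measurable_continuous_onI]) (rule continuous_on_component[OF continuous_on_id])

lemma measurable_mu_hat:
  fixes C :: "nat \<Rightarrow> 'a \<Rightarrow> real^'d"
  assumes [measurable]: "\<And>i. i \<in> {1..n} \<Longrightarrow> C i \<in> borel_measurable M"
  shows "(\<lambda>\<omega>. mu_hat n (\<lambda>i. C i \<omega>) j) \<in> borel_measurable M"
  unfolding mu_hat_def by measurable

lemma measurable_sigma_hat:
  fixes C :: "nat \<Rightarrow> 'a \<Rightarrow> real^'d"
  assumes [measurable]: "\<And>i. i \<in> {1..n} \<Longrightarrow> C i \<in> borel_measurable M"
  shows "(\<lambda>\<omega>. sigma_hat n (\<lambda>i. C i \<omega>) j) \<in> borel_measurable M"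
  unfolding sigma_hat_def mu_hat_def by measurable

text \<open>\<open>z\<close> may depend on the outcome because the extra point
  \<open>max 0 (mu_hat n cal j)\<close> of \<open>SUP_gwc_countable\<close> is random.\<close>

lemma measurable_score_z:
  fixes C :: "nat \<Rightarrow> 'a \<Rightarrow> real^'d"
  assumes [measurable]: "\<And>i. i \<in> {1..n} \<Longrightarrow> C i \<in> borel_measurable M"
    "a \<in> borel_measurable M" "z \<in> borel_measurable M"
  shows "(\<lambda>\<omega>. (a \<omega> - mu_z n (\<lambda>i. C i \<omega>) j (z \<omega>)) / sigma_z n (\<lambda>i. C i \<omega>) j (z \<omega>))
    \<in> borel_measurable M"
  unfolding sigma_z_def mu_z_def by measurable

lemma measurable_phi_gwc:
  fixes C :: "nat \<Rightarrow> 'a \<Rightarrow> real^'d"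
  assumes n: "n > 0"
    and C[measurable]: "\<And>i. i \<in> {1..n} \<Longrightarrow> C i \<in> borel_measurable M" "T \<in> borel_measurable M"
  shows "(\<lambda>\<omega>. phi_gwc n (\<lambda>i. C i \<omega>) (T \<omega>)) \<in> borel_measurable M"
proof -
  have [measurable]: "(\<lambda>\<omega>. mu_hat n (\<lambda>i. C i \<omega>) j) \<in> borel_measurable M" for j
    by (rule measurable_mu_hat) measurable
  have "countable ({0::real..} \<inter> \<rat>)"
    using countable_rat by blast
  then show ?thesis
    unfolding phi_gwc_def SUP_gwc_countable[OF n]
    by (intro borel_measurable_Max borel_measurable_sup borel_measurable_SUP
        borel_measurable_ereal measurable_score_z) (simp_all, measurable)
qed

text \<open>By \<open>conf_quantile_less_iff\<close> a strict sublevel set says that a count is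
  large enough, and a count is a finite sum of measurable indicators.\<close>

lemma measurable_conf_quantile:
  assumes "0 < \<alpha>" "\<alpha> < 1" and f[measurable]: "\<And>i. i \<in> {1..n} \<Longrightarrow> f i \<in> borel_measurable M"
  shows "(\<lambda>\<omega>. conf_quantile \<alpha> (map (\<lambda>i. f i \<omega>) [1..<n+1])) \<in> borel_measurable M"
proof (rule borel_measurableI_less)
  fix y
  have "card {i \<in> {1..n}. f i \<omega> < y} = (\<Sum>i=1..n. if f i \<omega> < y then 1 else 0)" for \<omega>
    by (simp add: sum.If_cases Int_def)
  then show "{\<omega>\<in>space M. conf_quantile \<alpha> (map (\<lambda>i. f i \<omega>) [1..<n+1]) < y} \<in> sets M"
    unfolding conf_quantile_less_iff[OF assms(1,2)] by simp
qed

lemma measurable_omega: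
  fixes C :: "nat \<Rightarrow> 'a \<Rightarrow> real^'d"
  assumes [measurable]: "\<And>i. i \<in> {1..n} \<Longrightarrow> C i \<in> borel_measurable M" "c \<in> borel_measurable M"
  shows "(\<lambda>\<omega>. omega n (\<lambda>i. C i \<omega>) j (c \<omega>)) \<in> borel_measurable M"
proof -
  have [measurable]: "(\<lambda>\<omega>. mu_hat n (\<lambda>i. C i \<omega>) j) \<in> borel_measurable M"
     "(\<lambda>\<omega>. sigma_hat n (\<lambda>i. C i \<omega>) j) \<in> borel_measurable M"
    by (rule measurable_mu_hat measurable_sigma_hat; measurable)+
  show ?thesis unfolding omega_def Let_def by measurable
qed

section \<open>Pooled scores and exchangeability\<close>

text \<open>\<open>mu_z\<close> and \<open>sigma_z\<close> read only the entries \<open>1..n\<close>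
  of \<open>e\<close>; entry \<open>n + 1\<close> enters as the value of \<open>z\<close>. One
  family \<open>e\<close> thus carries both the calibration and the test residuals.\<close>

definition pooled_score :: "nat \<Rightarrow> (nat \<Rightarrow> real^'d) \<Rightarrow> nat \<Rightarrow> real" where
  "pooled_score n e i = Max (range (\<lambda>j::'d.
      (e i $ j - mu_z n e j (e (n+1) $ j)) / sigma_z n e j (e (n+1) $ j)))"

text \<open>With \<open>z\<close> set to the last residual, both statistics become sums over all of
  \<open>1..n+1\<close>, which survive reindexing. Agreement is asked on \<open>1..n+1\<close> only,
  so that \<open>f\<close> may be a restricted function on the product space.\<close>

lemma pooled_score_permute:
  fixes e f :: "nat \<Rightarrow> real^'d"
  assumes p: "\<pi> permutes {1..n+1}"
    and f: "\<And>i. i \<in> {1..n+1} \<Longrightarrow> f i = e (\<pi> i)" and i: "i \<in> {1..n+1}"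
  shows "pooled_score n f i = pooled_score n e (\<pi> i)"
proof -
  have mu: "mu_z n e j (e (n+1) $ j) = (\<Sum>i\<in>{1..n+1}. e i $ j) / (real n + 1)" for e :: "nat \<Rightarrow> real^'d" and j
    by (simp add: mu_z_def)
  have sigma: "sigma_z n e j (e (n+1) $ j)
      = sqrt ((\<Sum>i\<in>{1..n+1}. (e i $ j - mu_z n e j (e (n+1) $ j))\<^sup>2) / n)" for e :: "nat \<Rightarrow> real^'d" and j
    by (simp add: sigma_z_def)
  have perm: "(\<Sum>i\<in>{1..n+1}. h (f i)) = (\<Sum>i\<in>{1..n+1}. h (e i))" for h :: "real^'d \<Rightarrow> real"
  proof -
    have "(\<Sum>i\<in>{1..n+1}. h (f i)) = (\<Sum>i\<in>{1..n+1}. h (e (\<pi> i)))"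
      by (intro sum.cong refl) (simp only: f)
    then show ?thesis using sum.permute[OF p, of "\<lambda>i. h (e i)"] by (simp only: comp_def)
  qed
  have eq: "mu_z n f j (f (n+1) $ j) = mu_z n e j (e (n+1) $ j)" for j
    unfolding mu perm[of "\<lambda>x. x $ j"] ..
  have "sigma_z n f j (f (n+1) $ j) = sigma_z n e j (e (n+1) $ j)" for j
    unfolding sigma eq perm[of "\<lambda>x. (x $ j - _)\<^sup>2"] ..
  then show ?thesis by (simp only: pooled_score_def eq f[OF i])
qed

text \<open>Nonnegativity makes the last residual an admissible \<open>z\<close> in the supremum of
  each coordinate.\<close>

lemma pooled_score_le_phi_gwc:
  fixes e :: "nat \<Rightarrow> real^'d"
  assumes "\<And>j. 0 \<le> e (n+1) $ j"
  shows "ereal (pooled_score n e i) \<le> phi_gwc n e (e i)"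
proof -
  let ?g = "\<lambda>j z. (e i $ j - mu_z n e j z) / sigma_z n e j z"
  have "pooled_score n e i \<in> range (\<lambda>j. ?g j (e (n+1) $ j))"
    unfolding pooled_score_def by (rule Max_in) auto
  then obtain j where "pooled_score n e i = ?g j (e (n+1) $ j)" by blast
  then have "ereal (pooled_score n e i) \<le> (SUP z\<in>{0..}. ereal (?g j z))"
    using assms[of j] by (simp only:) (rule SUP_upper, simp)
  also have "\<dots> \<le> phi_gwc n e (e i)"
    unfolding phi_gwc_def by (rule Max_ge) auto
  finally show ?thesis .
qed

lemma measurable_pooled_score:
  fixes e :: "nat \<Rightarrow> 'a \<Rightarrow> real^'d"
  assumes [measurable]: "\<And>i. i \<in> {1..n+1} \<Longrightarrow> e i \<in> borel_measurable M" and i: "i \<in> {1..n+1}"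
  shows "(\<lambda>\<omega>. pooled_score n (\<lambda>i. e i \<omega>) i) \<in> borel_measurable M"
  unfolding pooled_score_def
proof (intro borel_measurable_Max measurable_score_z)
  fix j :: 'd
  have [measurable]: "e i \<in> borel_measurable M" "e (n+1) \<in> borel_measurable M" using i by simp_all
  show "(\<lambda>\<omega>. e i \<omega> $ j) \<in> borel_measurable M" "(\<lambda>\<omega>. e (n+1) \<omega> $ j) \<in> borel_measurable M"
    by measurable
qed simp_all

text \<open>By \<open>card_rank_less\<close> every outcome lies in at least \<open>k\<close> of the
  events that a given score has fewer than \<open>k\<close> strict predecessors; exchangeability
  gives all these events the same probability.\<close>

lemma (in prob_space) exchangeable_rank_prob:
  fixes e :: "nat \<Rightarrow> 'a \<Rightarrow> real^'d"
  assumes e: "\<And>i. i \<in> {1..n+1} \<Longrightarrow> e i \<in> borel_measurable M"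
    and exch: "\<And>\<pi>. \<pi> permutes {1..n+1} \<Longrightarrow>
        distr M (PiM {1..n+1} (\<lambda>_. borel)) (\<lambda>\<omega>. \<lambda>i\<in>{1..n+1}. e (\<pi> i) \<omega>)
      = distr M (PiM {1..n+1} (\<lambda>_. borel)) (\<lambda>\<omega>. \<lambda>i\<in>{1..n+1}. e i \<omega>)"
    and k: "k \<le> n + 1"
  defines "V \<equiv> \<lambda>i \<omega>. pooled_score n (\<lambda>i. e i \<omega>) i"
  shows "{\<omega>\<in>space M. card {i\<in>{1..n+1}. V i \<omega> < V (n+1) \<omega>} < k} \<in> events"
    and "real k \<le> real (n + 1) * prob {\<omega>\<in>space M. card {i\<in>{1..n+1}. V i \<omega> < V (n+1) \<omega>} < k}"
proof -
  define I where "I = {1..n+1}"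
  define A where "A m = {\<omega>\<in>space M. card {i\<in>I. V i \<omega> < V m \<omega>} < k}" for m
  let ?P = "PiM I (\<lambda>_. borel :: (real^'d) measure)"
  define B where "B = {x\<in>space ?P. card {i\<in>I. pooled_score n x i < pooled_score n x (n+1)} < k}"
  have I: "finite I" "card I = n + 1" "n + 1 \<in> I" by (simp_all add: I_def)
  \<comment> \<open>Stated for an arbitrary measure because it serves both the sample space and the
    product space.\<close>
  have cnt: "{x\<in>space N. card {i\<in>I. W i x < (U x :: real)} < k} \<in> sets N"
    if [measurable]: "\<And>i. i \<in> I \<Longrightarrow> W i \<in> borel_measurable N" "U \<in> borel_measurable N"
    for W U and N :: "'b measure"
  proof -
    have "card {i\<in>I. W i x < U x} = (\<Sum>i\<in>I. if W i x < U x then 1 else 0)" for x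
      using I by (simp add: sum.If_cases Int_def)
    then show ?thesis by simp
  qed
  have V: "V i \<in> borel_measurable M" if "i \<in> I" for i
    using that e unfolding V_def I_def by (intro measurable_pooled_score)
  have A: "A m \<in> events" if "m \<in> I" for m
    unfolding A_def using V that by (intro cnt)
  have "(\<lambda>x. pooled_score n (\<lambda>i. x i) i) \<in> borel_measurable ?P" if "i \<in> I" for i
    using that unfolding I_def by (intro measurable_pooled_score[where e = "\<lambda>i x. x i"]) simp_all
  then have B: "B \<in> sets ?P" unfolding B_def using I by (intro cnt) simp_all
  have A_eq: "prob (A m) = prob (A (n+1))" if m: "m \<in> I" for m
  proof -
    \<comment> \<open>\<open>B\<close> is the rank event of the last coordinate in the product
      space; its preimage under the permuted sample is the rank event of index
      \<open>\<pi> (n+1)\<close>.\<close>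
    have meas: "measure (distr M ?P (\<lambda>\<omega>. \<lambda>i\<in>I. e (\<pi> i) \<omega>)) B = prob (A (\<pi> (n+1)))"
      if p: "\<pi> permutes I" for \<pi>
    proof -
      have F: "(\<lambda>\<omega>. \<lambda>i\<in>I. e (\<pi> i) \<omega>) \<in> measurable M ?P"
        using e permutes_in_image[OF p] by (intro measurable_restrict) (simp add: I_def)
      have "(\<lambda>\<omega>. \<lambda>i\<in>I. e (\<pi> i) \<omega>) -` B \<inter> space M = A (\<pi> (n+1))"
      proof -
        have sc: "pooled_score n (\<lambda>i\<in>I. e (\<pi> i) \<omega>) i = V (\<pi> i) \<omega>" if "i \<in> I" for i \<omega>
          unfolding V_def using p that unfolding I_def
          by (intro pooled_score_permute) simp_all
        have "card {i\<in>I. V (\<pi> i) \<omega> < V (\<pi> (n+1)) \<omega>} = card {i\<in>I. V i \<omega> < V (\<pi> (n+1)) \<omega>}" for \<omega>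
        proof (rule bij_betw_same_card[of \<pi>], rule bij_betw_subset[OF permutes_imp_bij[OF p]])
          show "\<pi> ` {i\<in>I. V (\<pi> i) \<omega> < V (\<pi> (n+1)) \<omega>} = {i\<in>I. V i \<omega> < V (\<pi> (n+1)) \<omega>}"
            using permutes_image[OF p] by (auto simp: permutes_in_image[OF p])
        qed auto
        then show ?thesis
          using measurable_space[OF F] I by (auto simp: A_def B_def sc cong: conj_cong)
      qed
      then show ?thesis using measure_distr[OF F B] by simp
    qed
    \<comment> \<open>The swap moves \<open>n + 1\<close> to \<open>m\<close>; the swapped and the
      original sample have equal laws, hence give \<open>B\<close> equal probability.\<close>
    have "Transposition.transpose m (n+1) permutes I" using m I by (intro permutes_swap_id)
    from meas[OF this] meas[OF permutes_id] exch[folded I_def, OF this]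
    show ?thesis by simp
  qed
  have "real k \<le> real (card I) * prob (A (n+1))"
  proof (rule equiprobable_cover[OF I(1), of A])
    fix \<omega> assume "\<omega> \<in> space M"
    then show "k \<le> card {m\<in>I. \<omega> \<in> A m}"
      using card_rank_less[of I k "\<lambda>i. V i \<omega>"] k I by (simp add: A_def)
  qed (use A A_eq in auto)
  then show "real k \<le> real (n + 1) * prob {\<omega>\<in>space M. card {i\<in>{1..n+1}. V i \<omega> < V (n+1) \<omega>} < k}"
    unfolding I(2) unfolding A_def I_def .
  show "{\<omega>\<in>space M. card {i\<in>{1..n+1}. V i \<omega> < V (n+1) \<omega>} < k} \<in> events"
    using A[OF I(3)] unfolding A_def I_def .
qed

section \<open>Coverage of the prediction set\<close>

text \<open>A quantile below the last pooled score would put at least \<open>k\<close> worst-case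
  scores below it, with \<open>k\<close> the quantile's rank. Each of them dominates the pooled
  score of the same index, which contradicts the rank bound.\<close>

lemma pooled_score_le_Q_gwc:
  fixes e :: "nat \<Rightarrow> real^'d"
  assumes \<alpha>: "0 < \<alpha>" "\<alpha> < 1" and nonneg: "\<And>j. 0 \<le> e (n+1) $ j"
    and rank: "card {i\<in>{1..n+1}. pooled_score n e i < pooled_score n e (n+1)}
      < nat \<lceil>(1 - \<alpha>) * (real n + 1)\<rceil>"
  shows "ereal (pooled_score n e (n+1)) \<le> Q_gwc n e \<alpha>"
proof (rule ccontr)
  let ?v = "pooled_score n e (n+1)"
  assume "\<not> ereal ?v \<le> Q_gwc n e \<alpha>"
  then have "conf_quantile \<alpha> (map (\<lambda>i. phi_gwc n e (e i)) [1..<n+1]) < ereal ?v"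
    by (simp add: Q_gwc_def not_le)
  then have "nat \<lceil>(1 - \<alpha>) * (real n + 1)\<rceil> \<le> card {i\<in>{1..n}. phi_gwc n e (e i) < ereal ?v}"
    unfolding conf_quantile_less_iff[OF \<alpha>] .
  also have "\<dots> \<le> card {i\<in>{1..n+1}. pooled_score n e i < ?v}"
  proof (intro card_mono subsetI CollectI)
    fix i assume "i \<in> {i\<in>{1..n}. phi_gwc n e (e i) < ereal ?v}"
    then show "i \<in> {1..n+1} \<and> pooled_score n e i < ?v"
      using le_less_trans[OF pooled_score_le_phi_gwc[of e n i], of "ereal ?v"] nonneg by auto
  qed simp
  finally show False using rank by (meson not_le)
qed

theorem theorem3p4:
  fixes M :: "'a measure" and MX :: "'x measure"
    and X :: "nat \<Rightarrow> 'a \<Rightarrow> 'x" and Y :: "nat \<Rightarrow> 'a \<Rightarrow> real^'d"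
    and E :: "'x \<Rightarrow> real^'d \<Rightarrow> real^'d"
    and n :: nat and \<alpha> :: real
  assumes "prob_space M"
    and "n \<ge> 2" and "0 < \<alpha>" and "\<alpha> < 1"
    and X_meas: "\<And>i. i \<in> {1..n+1} \<Longrightarrow> X i \<in> measurable M MX"
    and Y_meas: "\<And>i. i \<in> {1..n+1} \<Longrightarrow> Y i \<in> borel_measurable M"
    and E_meas: "(\<lambda>p. E (fst p) (snd p)) \<in> borel_measurable (MX \<Otimes>\<^sub>M borel)"
    and exch: "\<And>\<pi>. \<pi> permutes {1..n+1} \<Longrightarrow>
        distr M (PiM {1..n+1} (\<lambda>_. borel)) (\<lambda>\<omega>. \<lambda>i\<in>{1..n+1}. E (X (\<pi> i) \<omega>) (Y (\<pi> i) \<omega>))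
      = distr M (PiM {1..n+1} (\<lambda>_. borel)) (\<lambda>\<omega>. \<lambda>i\<in>{1..n+1}. E (X i \<omega>) (Y i \<omega>))"
    and no_atoms: "\<And>i j c. i \<in> {1..n+1} \<Longrightarrow>
        measure M {\<omega>\<in>space M. E (X i \<omega>) (Y i \<omega>) $ j = c} = 0"
    and nonneg: "\<And>i j. i \<in> {1..n+1} \<Longrightarrow> AE \<omega> in M. 0 \<le> E (X i \<omega>) (Y i \<omega>) $ j"
    and integ: "\<And>i j. i \<in> {1..n+1} \<Longrightarrow> integrable M (\<lambda>\<omega>. E (X i \<omega>) (Y i \<omega>) $ j)"
    and integ2: "\<And>i j. i \<in> {1..n+1} \<Longrightarrow> integrable M (\<lambda>\<omega>. (E (X i \<omega>) (Y i \<omega>) $ j)^2)"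
    and var_pos: "\<And>i j. i \<in> {1..n+1} \<Longrightarrow>
        0 < prob_space.variance M (\<lambda>\<omega>. E (X i \<omega>) (Y i \<omega>) $ j)"
    and distinct: "\<And>j. AE \<omega> in M. \<forall>i\<in>{1..n+1}. \<forall>k\<in>{1..n+1}.
        i \<noteq> k \<longrightarrow> E (X i \<omega>) (Y i \<omega>) $ j \<noteq> E (X k \<omega>) (Y k \<omega>) $ j"
  shows "measure M {\<omega>\<in>space M.
            Y (n+1) \<omega> \<in> C_gwc n (\<lambda>i. E (X i \<omega>) (Y i \<omega>)) \<alpha> E (X (n+1) \<omega>)} \<ge> 1 - \<alpha>"
proof -
  interpret prob_space M by (rule assms(1))
  define e where "e i \<omega> = E (X i \<omega>) (Y i \<omega>)" for i \<omega>
  define k where "k = nat \<lceil>(1 - \<alpha>) * (real n + 1)\<rceil>"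
  define D where "D = {\<omega>\<in>space M. card {i\<in>{1..n+1}.
      pooled_score n (\<lambda>i. e i \<omega>) i < pooled_score n (\<lambda>i. e i \<omega>) (n+1)} < k}"
  define G where "G = {\<omega>\<in>space M. \<forall>j. 0 \<le> e (n+1) \<omega> $ j \<and>
      ereal (e (n+1) \<omega> $ j) \<le> omega n (\<lambda>i. e i \<omega>) j (Q_gwc n (\<lambda>i. e i \<omega>) \<alpha>)}"
  have e: "e i \<in> borel_measurable M" if i: "i \<in> {1..n+1}" for i
    using measurable_compose[OF measurable_Pair[OF X_meas[OF i] Y_meas[OF i]] E_meas]
    by (simp add: e_def[abs_def])
  have k: "k \<le> n + 1" unfolding k_def using assms(3) by (rule quantile_index_le)
  have D: "D \<in> events" "real k \<le> real (n + 1) * prob D"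
    unfolding D_def using exchangeable_rank_prob[OF e exch[folded e_def] k] by blast+
  have G: "G \<in> events"
  proof -
    have en: "e (n+1) \<in> borel_measurable M" by (rule e) simp
    have ei: "e i \<in> borel_measurable M" if "i \<in> {1..n}" for i using that by (intro e) simp
    have Q: "(\<lambda>\<omega>. Q_gwc n (\<lambda>i. e i \<omega>) \<alpha>) \<in> borel_measurable M"
      unfolding Q_gwc_def using assms(2-4) ei
      by (intro measurable_conf_quantile measurable_phi_gwc) auto
    have [measurable]: "(\<lambda>\<omega>. omega n (\<lambda>i. e i \<omega>) j (Q_gwc n (\<lambda>i. e i \<omega>) \<alpha>)) \<in> borel_measurable M" for j
      using ei Q by (rule measurable_omega)
    note en[measurable]
    show ?thesis unfolding G_def by measurable
  qed
  \<comment> \<open>Nonnegativity is one half of membership in \<open>G\<close> and also admits the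
    last residual as a value of \<open>z\<close>.\<close>
  have "AE \<omega> in M. \<forall>j. 0 \<le> e (n+1) \<omega> $ j"
    unfolding AE_all_countable using nonneg[of "n+1"] by (simp add: e_def)
  \<comment> \<open>Two differing calibration residuals, available since \<open>n\<close> is at
    least 2, force the positive \<open>sigma_hat\<close> that \<open>le_omega\<close>
    requires.\<close>
  moreover have "AE \<omega> in M. \<forall>j. e 1 \<omega> $ j \<noteq> e 2 \<omega> $ j"
    unfolding AE_all_countable
  proof
    fix j show "AE \<omega> in M. e 1 \<omega> $ j \<noteq> e 2 \<omega> $ j"
      using distinct[of j] by eventually_elim (use assms(2) in \<open>simp add: e_def\<close>)
  qed
  ultimately have "AE \<omega> in M. \<omega> \<in> D \<longrightarrow> \<omega> \<in> G"
  proof eventually_elim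
    fix \<omega> assume nn: "\<forall>j. 0 \<le> e (n+1) \<omega> $ j" and dist: "\<forall>j. e 1 \<omega> $ j \<noteq> e 2 \<omega> $ j"
    let ?e = "\<lambda>i. e i \<omega>"
    let ?Q = "Q_gwc n ?e \<alpha>"
    show "\<omega> \<in> D \<longrightarrow> \<omega> \<in> G"
    proof
      assume D: "\<omega> \<in> D"
      have score: "ereal (pooled_score n ?e (n+1)) \<le> ?Q"
        using D nn assms(3,4) by (intro pooled_score_le_Q_gwc) (simp_all add: D_def k_def)
      have "ereal (e (n+1) \<omega> $ j) \<le> omega n ?e j ?Q" for j
      proof (rule le_omega)
        show "0 < sigma_hat n ?e j"
          using dist assms(2) by (intro sigma_hat_pos[of 1 n 2]) auto
        \<comment> \<open>The pooled score is a maximum over coordinates, so a single quantile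
          controls every coordinate at once.\<close>
        have "(e (n+1) \<omega> $ j - mu_z n ?e j (e (n+1) \<omega> $ j)) / sigma_z n ?e j (e (n+1) \<omega> $ j)
            \<le> pooled_score n ?e (n+1)"
          unfolding pooled_score_def by (rule Max_ge) auto
        then show "ereal ((e (n+1) \<omega> $ j - mu_z n ?e j (e (n+1) \<omega> $ j)) / sigma_z n ?e j (e (n+1) \<omega> $ j)) \<le> ?Q"
          using score by (simp add: order_trans[OF _ score])
      qed (use nn assms(2) in auto)
      then show "\<omega> \<in> G" using nn D by (simp add: G_def D_def)
    qed
  qed
  then have "prob D \<le> prob G" using G by (rule finite_measure_mono_AE)
  \<comment> \<open>Rounding the rank up makes \<open>k / (n + 1)\<close> at least
    \<open>1 - \<alpha>\<close>.\<close>
  moreover have "(1 - \<alpha>) * (real n + 1) \<le> real k" unfolding k_def by linarith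
  ultimately have "(1 - \<alpha>) * (real n + 1) \<le> prob G * (real n + 1)"
    using D(2) mult_right_mono[of "prob D" "prob G" "real n + 1"] by (simp add: algebra_simps)
  then have "1 - \<alpha> \<le> prob G" by (rule mult_right_le_imp_le) simp
  also have "G = {\<omega>\<in>space M. Y (n+1) \<omega> \<in> C_gwc n (\<lambda>i. E (X i \<omega>) (Y i \<omega>)) \<alpha> E (X (n+1) \<omega>)}"
    by (simp add: G_def C_gwc_def e_def)
  finally show ?thesis .
qed

end
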